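(* Let $s_1,\dots,s_N$ be solution candidates with success probabilities $p_i\in[0,1]$ and execution times $t_i>0$, ordered so that $\frac{p_1}{t_1}\ge\frac{p_2}{t_2}\ge\dots\ge\frac{p_N}{t_N}$, and let $\frac{p_k}{t_k}-\frac{p_{k+1}}{t_{k+1}}>0$ for some $k$. Then following the optimal strategy $s_1,\dots,s_N$ with the $(k+1)$-th candidate tried just before the $k$-th one (a solver's error), i.e. using the order $s_1,\dots,s_{k-1},s_{k+1},s_k,s_{k+2},\dots,s_N$, yields a sub-optimal expected amount of time spent before either finding a solution or discovering that none of the candidates works, and the expected excess $EXC$ (the expected time of this modified strategy minus that of the optimal strategy) can be quantified as $$EXC=\left(\frac{p_k}{t_k}-\frac{p_{k+1}}{t_{k+1}}\right)\prod_{j=1}^{k-1}(1-p_j)\cdot t_kt_{k+1}.$$ Furthermore, $$\left(\frac{p_k}{t_k}-\frac{p_{k+1}}{t_{k+1}}\right)t_kt_{k+1}\cdot e^{-S_{k-1}}\ \ge\ EXC\ \ge\ \left(\frac{p_k}{t_k}-\frac{p_{k+1}}{t_{k+1}}\right)t_kt_{k+1}\cdot\left(1-S_{k-1}+(k-2)P_{k-1}^{\frac{k-1}{2k-4}}\right).$$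
   Context: $S_m=\sum_{i=1}^m p_i$ and $P_m=\prod_{i=1}^m p_i$. Successes of different candidates are independent, the $p_i$ need not sum to 1, and each candidate is tried at most once. A strategy is an ordering of the candidates, i.e. a permutation $\tau$ of $\{1,\dots,N\}$; its expected time spent before either finding a solution or discovering that no candidate works is $$E(\tau)=\sum_{k=1}^{N}\Big(\sum_{l=1}^{k} t_{\tau(l)}\Big)\Big(\prod_{j=1}^{k-1}(1-p_{\tau(j)})\Big)p_{\tau(k)}+\Big(\sum_{l=1}^{N}t_l\Big)\prod_{j=1}^{N}(1-p_j).$$ The optimal strategy is to try the candidates in the order of decreasing $p_i/t_i$.
   Formalization: Sub-optimality is claimed exactly when no p_j with j<k equals 1 (if some p_j=1, then EXC=0 and the modified order is still optimal); for k=2 the term (k-2)P_{k-1}^{(k-1)/(2k-4)}, whose exponent is undefined, is read as 0. *)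

theory Defs
  imports Complex_Main "HOL-Combinatorics.Permutations"
begin

text \<open>
  The candidates are the indices \<open>1, \<dots>, N\<close>, with success probabilities \<open>p i\<close> and execution
  times \<open>t i\<close>.  A strategy is a permutation \<open>\<tau>\<close> of \<open>{1..N}\<close>, where \<open>\<tau> l\<close> is the candidate that is
  tried in position \<open>l\<close>.
\<close>

text \<open>
  The \<open>k\<close>-th summand is the case that the \<open>k\<close>-th trial is the first success; the last term
  is the case that every candidate fails.
\<close>

definition expected_time ::
    "nat \<Rightarrow> (nat \<Rightarrow> real) \<Rightarrow> (nat \<Rightarrow> real) \<Rightarrow> (nat \<Rightarrow> nat) \<Rightarrow> real" where
  "expected_time N p t \<tau> =
     (\<Sum>k = 1..N. (\<Sum>l = 1..k. t (\<tau> l)) * (\<Prod>j = 1..<k. 1 - p (\<tau> j)) * p (\<tau> k))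
     + (\<Sum>l = 1..N. t l) * (\<Prod>j = 1..N. 1 - p j)"

definition optimal_strategy ::
    "nat \<Rightarrow> (nat \<Rightarrow> real) \<Rightarrow> (nat \<Rightarrow> real) \<Rightarrow> (nat \<Rightarrow> nat) \<Rightarrow> bool" where
  "optimal_strategy N p t \<tau> \<longleftrightarrow>
     \<tau> permutes {1..N} \<and>
     (\<forall>\<sigma>. \<sigma> permutes {1..N} \<longrightarrow> expected_time N p t \<tau> \<le> expected_time N p t \<sigma>)"

definition suboptimal_strategy ::
    "nat \<Rightarrow> (nat \<Rightarrow> real) \<Rightarrow> (nat \<Rightarrow> real) \<Rightarrow> (nat \<Rightarrow> nat) \<Rightarrow> bool" where
  "suboptimal_strategy N p t \<tau> \<longleftrightarrow>
     \<tau> permutes {1..N} \<and>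
     (\<exists>\<sigma>. \<sigma> permutes {1..N} \<and> expected_time N p t \<sigma> < expected_time N p t \<tau>)"

text \<open>
  The strategy \<open>transpose k (Suc k)\<close> is the order
  \<open>1, \<dots>, k - 1, k + 1, k, k + 2, \<dots>, N\<close>, and \<open>id\<close> is the order \<open>1, \<dots>, N\<close>.
\<close>

definition EXC :: "nat \<Rightarrow> (nat \<Rightarrow> real) \<Rightarrow> (nat \<Rightarrow> real) \<Rightarrow> nat \<Rightarrow> real" where
  "EXC N p t k = expected_time N p t (transpose k (Suc k)) - expected_time N p t id"

definition partial_sum :: "(nat \<Rightarrow> real) \<Rightarrow> nat \<Rightarrow> real" where
  "partial_sum p m = (\<Sum>i = 1..m. p i)"

definition partial_prod :: "(nat \<Rightarrow> real) \<Rightarrow> nat \<Rightarrow> real" where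
  "partial_prod p m = (\<Prod>i = 1..m. p i)"

end

theory Submission
  imports Defs "HOL-Analysis.Convex" "HOL-Analysis.Infinite_Products"
begin

text \<open>
  The candidate in position \<open>k\<close> is executed exactly when all earlier ones fail, so the expected
  time of a strategy is \<open>\<Sum>\<^sub>k t\<^sub>k \<Prod>\<^sub>j\<^sub><\<^sub>k (1 - p\<^sub>j)\<close>, each candidate contributing its execution time
  weighted by the probability of being reached (\<open>expected_time_eq_search_cost\<close>).  As a function of
  the list of candidates this weighted sum has a recursive form, and concatenation is compatible
  with it: a suffix contributes its own cost times the probability that the whole prefix fails.

  Consequently, exchanging two neighbours \<open>x, y\<close> changes the cost by
  \<open>p\<^sub>x t\<^sub>y - p\<^sub>y t\<^sub>x\<close> times the probability that everything before them fails.  The sign of this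
  is governed by \<open>p\<^sub>x / t\<^sub>x - p\<^sub>y / t\<^sub>y\<close>.  Repeated exchanges of this kind turn any order into any
  prescribed order of decreasing ratio without increasing the cost, so the latter is optimal; a single
  exchange gives the formula for the excess.

  The two bounds concern only \<open>\<Prod>\<^sub>j (1 - p\<^sub>j)\<close>.  The upper one is \<open>1 - x \<le> exp (- x)\<close> in each
  factor.  For the lower one, let \<open>M\<close> be the largest of the \<open>p\<^sub>j\<close>, split off its factor, and estimate
  the others by the Weierstrass inequality \<open>\<Prod>(1 - p\<^sub>j) \<ge> 1 - \<Sum>p\<^sub>j\<close>.  What is gained over
  \<open>1 - \<Sum>p\<^sub>j\<close> is \<open>M\<close> times the sum of the remaining probabilities, and the arithmetic-geometric mean
  inequality bounds this below by a power of the product (\<open>prod_one_minus_ge\<close>).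
\<close>

(* Below, transpose is the permutation that exchanges two points, not the transpose of a matrix. *)
hide_const (open) Finite_Cartesian_Product.transpose

section \<open>Cost of a list of candidates\<close>

fun search_cost :: "('a \<Rightarrow> real) \<Rightarrow> ('a \<Rightarrow> real) \<Rightarrow> 'a list \<Rightarrow> real" where
  "search_cost p t [] = 0"
| "search_cost p t (x # xs) = t x + (1 - p x) * search_cost p t xs"

lemma search_cost_append:
  "search_cost p t (xs @ ys) =
    search_cost p t xs + (\<Prod>x\<leftarrow>xs. 1 - p x) * search_cost p t ys"
  by (induction xs) (auto simp: algebra_simps)

lemma search_cost_swap:
  "search_cost p t (xs @ y # x # ys) - search_cost p t (xs @ x # y # ys) =
    (\<Prod>z\<leftarrow>xs. 1 - p z) * (p x * t y - p y * t x)"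
  by (simp add: search_cost_append algebra_simps)

lemma prod_list_map_upt:
  "(\<Prod>x\<leftarrow>map \<tau> [1..<Suc n]. f x) = (\<Prod>j = 1..n. f (\<tau> j) :: real)"
  by (induction n) (auto simp: mult.commute)

text \<open>
  Summation by parts: a trial in position \<open>n + 1\<close> adds its execution time to the total time both
  when it succeeds and when it fails, that is, whenever the first \<open>n\<close> trials fail.
\<close>

lemma first_success_time_eq_search_cost:
  fixes p t :: "'a \<Rightarrow> real"
  shows "(\<Sum>k = 1..n. (\<Sum>l = 1..k. t (\<tau> l)) * (\<Prod>j = 1..<k. 1 - p (\<tau> j)) * p (\<tau> k))
      + (\<Sum>l = 1..n. t (\<tau> l)) * (\<Prod>j = 1..n. 1 - p (\<tau> j))
    = search_cost p t (map \<tau> [1..<Suc n])"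
proof (induction n)
  case 0
  show ?case by simp
next
  case (Suc n)
  have "search_cost p t (map \<tau> [1..<Suc (Suc n)]) =
      search_cost p t (map \<tau> [1..<Suc n]) + (\<Prod>j = 1..n. 1 - p (\<tau> j)) * t (\<tau> (Suc n))"
    using prod_list_map_upt[of "\<lambda>x. 1 - p x" \<tau> n] by (simp add: search_cost_append o_def)
  also note Suc.IH[symmetric]
  finally show ?case
    by (simp add: atLeastLessThanSuc_atLeastAtMost algebra_simps)
qed

lemma expected_time_eq_search_cost:
  assumes "\<tau> permutes {1..N}"
  shows "expected_time N p t \<tau> = search_cost p t (map \<tau> [1..<Suc N])"
proof -
  \<comment> \<open>The all-fail term of the definition does not mention the order; it is symmetric.\<close>
  have "(\<Sum>l = 1..N. t l) = (\<Sum>l = 1..N. t (\<tau> l))"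
    "(\<Prod>j = 1..N. 1 - p j) = (\<Prod>j = 1..N. 1 - p (\<tau> j))"
    using sum.permute[OF assms, of t] prod.permute[OF assms, of "\<lambda>j. 1 - p j"]
    by (simp_all add: o_def)
  then show ?thesis
    by (simp only: expected_time_def first_success_time_eq_search_cost)
qed


section \<open>Optimality of the order of decreasing ratio\<close>

text \<open>
  Moving \<open>y\<close> forward past elements of smaller or equal ratio is a sequence of neighbour exchanges,
  none of which increases the cost.  The ratio condition is cross-multiplied.
\<close>

lemma search_cost_move_to_front:
  assumes "\<And>x. x \<in> set us \<Longrightarrow> p x \<le> 1"
    and "\<And>x. x \<in> set us \<Longrightarrow> p x * t y \<le> p y * t x"
  shows "search_cost p t (y # us @ vs) \<le> search_cost p t (us @ y # vs)"
  using assms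
proof (induction us)
  case Nil
  show ?case by simp
next
  case (Cons u us)
  have "search_cost p t (y # u # us @ vs) \<le> search_cost p t (u # y # us @ vs)"
    using search_cost_swap[of p t "[]" y u "us @ vs"] Cons.prems(2)[of u] by simp
  also have "\<dots> \<le> search_cost p t (u # us @ y # vs)"
    using Cons.IH Cons.prems(1)[of u] Cons.prems by (auto intro!: mult_left_mono)
  finally show ?case by simp
qed

text \<open>
  By induction along the sorted list: its head is found somewhere in the other list and is moved to
  the front there, after which the tails are compared.  Since elements of equal ratio may be
  exchanged freely, ties need no separate treatment.
\<close>

lemma search_cost_sorted_le:
  assumes "mset xs = mset ys"
    and "sorted_wrt (\<lambda>y x. p x * t y \<le> p y * t x) ys"
    and "\<And>x. x \<in> set ys \<Longrightarrow> p x \<le> 1"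
  shows "search_cost p t ys \<le> search_cost p t xs"
  using assms
proof (induction ys arbitrary: xs)
  case Nil
  then show ?case by simp
next
  case (Cons y ys)
  from Cons.prems(1) have "y \<in> set xs"
    by (metis list.set_intros(1) mset_eq_setD)
  then obtain us vs where xs: "xs = us @ y # vs"
    by (meson split_list)
  have rest: "mset (us @ vs) = mset ys"
    using Cons.prems(1) xs by simp
  have us: "x \<in> set ys" if "x \<in> set us" for x
    using that mset_eq_setD[OF rest] by auto
  have "search_cost p t ys \<le> search_cost p t (us @ vs)"
    using Cons.prems rest by (intro Cons.IH) auto
  then have "search_cost p t (y # ys) \<le> search_cost p t (y # us @ vs)"
    using Cons.prems(3)[of y] by (auto intro!: mult_left_mono)
  also have "\<dots> \<le> search_cost p t xs"
    unfolding xs using Cons.prems us by (intro search_cost_move_to_front) auto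
  finally show ?case .
qed

lemma optimal_strategy_id:
  fixes p t :: "nat \<Rightarrow> real"
  assumes "\<And>i. i \<in> {1..N} \<Longrightarrow> p i \<le> 1"
    and t: "\<And>i. i \<in> {1..N} \<Longrightarrow> t i > 0"
    and mono: "\<And>i. i \<in> {1..<N} \<Longrightarrow> p i / t i \<ge> p (i + 1) / t (i + 1)"
  shows "optimal_strategy N p t id"
proof -
  have antimono: "p j / t j \<le> p i / t i" if "1 \<le> i" "i \<le> j" "j \<le> N" for i j
    using that(2,3)
  proof (induction j rule: dec_induct)
    case (step n)
    then show ?case using mono[of n] that(1) by auto
  qed simp
  have sorted: "sorted_wrt (\<lambda>y x. p x * t y \<le> p y * t x) [1..<Suc N]"
    unfolding sorted_wrt_iff_nth_less
  proof (intro allI impI)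
    fix i j assume ij: "i < j" "j < length [1..<Suc N]"
    then have "p (Suc j) / t (Suc j) \<le> p (Suc i) / t (Suc i)" "t (Suc i) > 0" "t (Suc j) > 0"
      using antimono[of "Suc i" "Suc j"] t[of "Suc i"] t[of "Suc j"]
      by (auto simp del: upt_Suc)
    then have "p (Suc j) * t (Suc i) \<le> p (Suc i) * t (Suc j)"
      by (simp add: field_simps)
    then show "p ([1..<Suc N] ! j) * t ([1..<Suc N] ! i) \<le> p ([1..<Suc N] ! i) * t ([1..<Suc N] ! j)"
      using ij by (simp del: upt_Suc)
  qed
  have "expected_time N p t id \<le> expected_time N p t \<sigma>" if \<sigma>: "\<sigma> permutes {1..N}" for \<sigma>
  proof -
    have "mset (map \<sigma> [1..<Suc N]) = mset [1..<Suc N]"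
      using permutes_image_mset[OF \<sigma>]
      by (simp add: atLeastLessThanSuc_atLeastAtMost mset_upt del: upt_Suc)
    then have "search_cost p t [1..<Suc N] \<le> search_cost p t (map \<sigma> [1..<Suc N])"
      using sorted assms(1) by (intro search_cost_sorted_le) auto
    then show ?thesis
      using \<sigma> by (simp add: expected_time_eq_search_cost permutes_id del: upt_Suc)
  qed
  then show ?thesis
    by (simp add: optimal_strategy_def permutes_id)
qed

lemma transpose_Suc_permutes:
  assumes "k \<in> {1..<N}"
  shows "transpose k (Suc k) permutes {1..N}"
  using assms by (intro permutes_swap_id) auto

lemma EXC_eq:
  fixes p t :: "nat \<Rightarrow> real"
  assumes "k \<in> {1..<N}"
  shows "EXC N p t k = (\<Prod>j = 1..k - 1. 1 - p j) * (p k * t (Suc k) - p (Suc k) * t k)"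
proof -
  have split: "[1..<Suc N] = [1..<k] @ k # Suc k # [Suc (Suc k)..<Suc N]"
  proof -
    have "[1..<Suc N] = [1..<k] @ [k..<Suc N]"
      using assms upt_add_eq_append[of 1 k "Suc N - k"] by (simp del: upt_Suc)
    also have "[k..<Suc N] = k # Suc k # [Suc (Suc k)..<Suc N]"
      using assms by (simp add: upt_conv_Cons del: upt_Suc)
    finally show ?thesis .
  qed
  have "map (transpose k (Suc k)) [1..<Suc N] = [1..<k] @ Suc k # k # [Suc (Suc k)..<Suc N]"
    unfolding split by (auto simp: transpose_def intro!: map_idI simp del: upt_Suc)
  then have "expected_time N p t (transpose k (Suc k)) =
      search_cost p t ([1..<k] @ Suc k # k # [Suc (Suc k)..<Suc N])"
    using expected_time_eq_search_cost[OF transpose_Suc_permutes[OF assms]] by metis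
  moreover have "expected_time N p t id =
      search_cost p t ([1..<k] @ k # Suc k # [Suc (Suc k)..<Suc N])"
    using expected_time_eq_search_cost[OF permutes_id, of N p t] unfolding split by simp
  ultimately have "EXC N p t k = (\<Prod>x\<leftarrow>[1..<k]. 1 - p x) * (p k * t (Suc k) - p (Suc k) * t k)"
    by (simp only: EXC_def search_cost_swap)
  then show ?thesis
    using prod_list_map_upt[of "\<lambda>x. 1 - p x" id "k - 1"] assms by (simp del: upt_Suc)
qed


section \<open>Bounds for a product of complementary probabilities\<close>

lemma prod_one_minus_le_exp:
  fixes p :: "'a \<Rightarrow> real"
  assumes "\<And>i. i \<in> A \<Longrightarrow> p i \<le> 1"
  shows "(\<Prod>i\<in>A. 1 - p i) \<le> exp (- (\<Sum>i\<in>A. p i))"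
proof (cases "finite A")
  case True
  have "(\<Prod>i\<in>A. 1 - p i) \<le> (\<Prod>i\<in>A. exp (- p i))"
    using assms exp_ge_add_one_self[of "- p i" for i] by (intro prod_mono) auto
  also have "\<dots> = exp (- (\<Sum>i\<in>A. p i))"
    using True by (simp add: exp_sum flip: sum_negf)
  finally show ?thesis .
qed simp

text \<open>
  With \<open>M\<close> the maximum and \<open>n\<close> the number of the remaining indices, the arithmetic-geometric mean
  inequality yields the \<open>n\<close>-th root of \<open>M ^ (n - 1) * P\<close>, where \<open>P\<close> is the full product.  Since
  \<open>P\<close> contains \<open>M\<close> and at least one further factor of size at most \<open>M\<close>, we have
  \<open>M \<ge> P powr (1/2)\<close>, which eliminates \<open>M\<close> and leaves the exponent \<open>((n - 1) / 2 + 1) / n\<close>.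
  For two indices the bound is an equality.
\<close>

lemma prod_one_minus_ge:
  fixes p :: "'a \<Rightarrow> real"
  assumes fin: "finite A" and card: "card A \<ge> 2"
    and p: "\<And>i. i \<in> A \<Longrightarrow> 0 \<le> p i \<and> p i \<le> 1"
  shows "1 - (\<Sum>i\<in>A. p i)
      + (real (card A) - 1) * (\<Prod>i\<in>A. p i) powr (real (card A) / (2 * (real (card A) - 1)))
    \<le> (\<Prod>i\<in>A. 1 - p i)"
proof -
  have "A \<noteq> {}" using card by auto
  then have "Max (p ` A) \<in> p ` A" using fin by (intro Max_in) auto
  then obtain m where m: "m \<in> A" and "Max (p ` A) = p m" by blast
  then have max: "p i \<le> p m" if "i \<in> A" for i
    using fin that by (metis Max_ge finite_imageI imageI)
  define B where "B = A - {m}"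
  define n where "n = card B"
  define M where "M = p m"
  define P where "P = (\<Prod>i\<in>A. p i)"
  have B: "finite B" "A = insert m B" "m \<notin> B"
    using fin m by (auto simp: B_def)
  then have cardA: "card A = Suc n" and n: "n \<ge> 1"
    using card by (auto simp: n_def)
  then have "B \<noteq> {}" by (auto simp: n_def)
  then obtain b where b: "b \<in> B" by blast
  have M: "0 \<le> M" "M \<le> 1" using p m by (auto simp: M_def)
  have P: "P = M * (\<Prod>i\<in>B. p i)" "P \<ge> 0"
    using B p by (auto simp: P_def M_def intro!: mult_nonneg_nonneg prod_nonneg)

  have "(\<Prod>i\<in>B. p i) = p b * (\<Prod>i\<in>B - {b}. p i)"
    using B(1) b by (rule prod.remove)
  also have "\<dots> \<le> M * 1"
    unfolding M_def using b B p max by (intro mult_mono prod_le_1 prod_nonneg) auto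
  finally have PM: "P \<le> M\<^sup>2"
    unfolding P(1) power2_eq_square using M by (intro mult_left_mono) auto

  have root: "P powr ((real n + 1) / (2 * real n)) \<le> (\<Prod>i\<in>B. M * p i) powr (1 / real n)"
  proof -
    have "P powr ((real n - 1) / 2) \<le> (M\<^sup>2) powr ((real n - 1) / 2)"
      using P PM n by (intro powr_mono2) auto
    also have "\<dots> \<le> M ^ (n - 1)"
    proof (cases "M = 0")
      case False
      then have "M > 0" using M by simp
      then show ?thesis
        using n by (simp add: powr_powr powr_realpow[symmetric] of_nat_diff diff_divide_distrib
            flip: powr_numeral)
    qed simp
    finally have "P powr ((real n - 1) / 2) * P \<le> M ^ (n - 1) * P"
      using P(2) by (rule mult_right_mono)
    also have "M ^ (n - 1) * P = (\<Prod>i\<in>B. M * p i)"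
      using n P(1) by (cases n) (auto simp: prod.distrib n_def[symmetric])
    also have "P powr ((real n - 1) / 2) * P = P powr ((real n + 1) / 2)"
    proof (cases "P = 0")
      case False
      then have "P powr ((real n - 1) / 2) * P = P powr ((real n - 1) / 2 + 1)"
        using P(2) by (simp add: powr_add)
      also have "(real n - 1) / 2 + 1 = (real n + 1) / 2"
        by (simp add: field_simps)
      finally show ?thesis .
    qed simp
    finally have "(P powr ((real n + 1) / 2)) powr (1 / real n) \<le> (\<Prod>i\<in>B. M * p i) powr (1 / real n)"
      by (intro powr_mono2) auto
    then show ?thesis by (simp add: powr_powr)
  qed
  also have "\<dots> \<le> (\<Sum>i\<in>B. M * p i / real n)"
    unfolding n_def using B b p M by (intro arith_geom_mean) auto
  also have "\<dots> = M * (\<Sum>i\<in>B. p i) / real n"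
    by (simp add: sum_distrib_left sum_divide_distrib)
  finally have gain: "real n * P powr ((real n + 1) / (2 * real n)) \<le> M * (\<Sum>i\<in>B. p i)"
    using n by (simp add: field_simps)

  have "1 - (\<Sum>i\<in>B. p i) \<le> (\<Prod>i\<in>B. 1 - p i)"
    using B p by (intro Weierstrass_prod_ineq) auto
  then have "(1 - M) * (1 - (\<Sum>i\<in>B. p i)) \<le> (1 - M) * (\<Prod>i\<in>B. 1 - p i)"
    using M by (intro mult_left_mono) auto
  also have "\<dots> = (\<Prod>i\<in>A. 1 - p i)"
    using B by (simp add: M_def)
  finally have "1 - (\<Sum>i\<in>A. p i) + M * (\<Sum>i\<in>B. p i) \<le> (\<Prod>i\<in>A. 1 - p i)"
    using B by (simp add: M_def algebra_simps)
  then show ?thesis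
    using gain by (simp add: cardA P_def add.commute)
qed


section \<open>The excess of a single exchange\<close>

(* If some p j with j < k equals 1, the two candidates are never reached with positive probability
   and the excess is 0; so the swapped order is suboptimal exactly when no such j exists.
   For k = 2 the exponent has denominator 0, but its term carries the factor k - 2 = 0. *)
theorem theorem3p4:
  fixes N k :: nat and p t :: "nat \<Rightarrow> real"
  assumes "\<And>i. i \<in> {1..N} \<Longrightarrow> 0 \<le> p i \<and> p i \<le> 1"
    and "\<And>i. i \<in> {1..N} \<Longrightarrow> t i > 0"
    and "\<And>i. i \<in> {1..<N} \<Longrightarrow> p i / t i \<ge> p (i + 1) / t (i + 1)"
    and "k \<in> {1..<N}"
    and "p k / t k - p (k + 1) / t (k + 1) > 0"
  shows "optimal_strategy N p t id
    \<and> (suboptimal_strategy N p t (transpose k (Suc k)) \<longleftrightarrow> (\<forall>j\<in>{1..<k}. p j \<noteq> 1))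
    \<and> EXC N p t k =
        (p k / t k - p (k + 1) / t (k + 1)) * (\<Prod>j = 1..k - 1. 1 - p j) * (t k * t (k + 1))
    \<and> (p k / t k - p (k + 1) / t (k + 1)) * t k * t (k + 1) * exp (- partial_sum p (k - 1))
        \<ge> EXC N p t k
    \<and> EXC N p t k \<ge>
        (p k / t k - p (k + 1) / t (k + 1)) * t k * t (k + 1) *
          (1 - partial_sum p (k - 1)
             + (real k - 2) * partial_prod p (k - 1) powr ((real k - 1) / (2 * real k - 4)))"
proof -
  define D where "D = (p k / t k - p (k + 1) / t (k + 1)) * t k * t (k + 1)"
  define Q where "Q = (\<Prod>j = 1..k - 1. 1 - p j)"
  have tpos: "t k > 0" "t (k + 1) > 0" using assms(2,4) by auto
  then have D: "D > 0" using assms(5) by (simp add: D_def)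
  have prefix: "0 \<le> p j \<and> p j \<le> 1" if "j \<in> {1..k - 1}" for j
    using assms(1,4) that by auto
  have "D = p k * t (Suc k) - p (Suc k) * t k"
    using tpos by (simp add: D_def field_simps)
  then have EXC: "EXC N p t k = D * Q"
    using EXC_eq[OF assms(4), of p t] by (simp add: Q_def)

  have opt: "optimal_strategy N p t id"
    using assms(1-3) by (intro optimal_strategy_id) auto

  have "Q \<ge> 0" unfolding Q_def using prefix by (intro prod_nonneg) auto
  moreover have "Q = 0 \<longleftrightarrow> (\<exists>j\<in>{1..<k}. p j = 1)"
    unfolding Q_def by (auto simp: Bex_def)
  ultimately have "EXC N p t k > 0 \<longleftrightarrow> (\<forall>j\<in>{1..<k}. p j \<noteq> 1)"
    using D unfolding EXC zero_less_mult_iff by (metis less_eq_real_def not_less_iff_gr_or_eq)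
  \<comment> \<open>As \<open>id\<close> is optimal, it beats every strategy that is beaten at all.\<close>
  moreover have "suboptimal_strategy N p t (transpose k (Suc k)) \<longleftrightarrow> EXC N p t k > 0"
    using opt transpose_Suc_permutes[OF assms(4)]
    unfolding suboptimal_strategy_def optimal_strategy_def EXC_def diff_gt_0_iff_gt
    by (meson le_less_trans)
  ultimately have sub:
    "suboptimal_strategy N p t (transpose k (Suc k)) \<longleftrightarrow> (\<forall>j\<in>{1..<k}. p j \<noteq> 1)"
    by blast

  have upper: "Q \<le> exp (- partial_sum p (k - 1))"
    unfolding Q_def partial_sum_def using prefix by (intro prod_one_minus_le_exp) auto

  have lower: "1 - partial_sum p (k - 1)
      + (real k - 2) * partial_prod p (k - 1) powr ((real k - 1) / (2 * real k - 4)) \<le> Q"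
  proof -
    consider "k = 1" | "k = 2" | "k \<ge> 3" using assms(4) by force
    then show ?thesis
    proof cases
      case 1
      \<comment> \<open>All sums and products are empty, and the negative factor \<open>k - 2\<close> makes the bound 0.\<close>
      then show ?thesis by (simp add: Q_def partial_sum_def partial_prod_def)
    next
      case 2
      then show ?thesis by (simp add: Q_def partial_sum_def)
    next
      case 3
      then have "real (k - 1) = real k - 1" "2 * (real k - 1 - 1) = 2 * real k - 4"
        "real k - 1 - 1 = real k - 2"
        by auto
      then show ?thesis
        using prod_one_minus_ge[of "{1..k - 1}" p] prefix 3
        by (simp add: Q_def partial_sum_def partial_prod_def)
    qed
  qed

  have "EXC N p t k = (p k / t k - p (k + 1) / t (k + 1)) * Q * (t k * t (k + 1))"
    unfolding EXC D_def by simp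
  moreover have "EXC N p t k \<le> D * exp (- partial_sum p (k - 1))"
    unfolding EXC using D upper by simp
  moreover have "D * (1 - partial_sum p (k - 1)
      + (real k - 2) * partial_prod p (k - 1) powr ((real k - 1) / (2 * real k - 4))) \<le> EXC N p t k"
    unfolding EXC using D lower by simp
  ultimately show ?thesis
    using opt sub unfolding D_def Q_def by blast
qed

end
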